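(* Let $\rho\geq 1$ and let $T_0,T_1\in C_\rho(H)$. If $T_1$ is Harnack dominated by $T_0$ in $C_\rho(H)$, then $\Gamma(T_1)\subseteq\Gamma(T_0)$.
   Context: $H$ is a complex Hilbert space and $B(H)$ is the algebra of bounded linear operators on $H$; $\mathbb{D}$ is the open unit disc and $\mathbb{T}$ the unit circle. For $\rho>0$, $C_\rho(H)$ is the set of all $T\in B(H)$ admitting a unitary $\rho$-dilation: there are a Hilbert space $\mathcal{H}$ containing $H$ as a closed subspace and a unitary $U\in B(\mathcal{H})$ with $T^n=\rho P_H U^n|_H$ for all integers $n\ge 1$, where $P_H$ is the orthogonal projection of $\mathcal H$ onto $H$. Every $T\in C_\rho(H)$ has $\sigma(T)\subseteq\overline{\mathbb{D}}$, and its $\rho$-kernel is $K_z^\rho(T)=(I-\overline{z}T)^{-1}+(I-zT^* )^{-1}+(\rho-2)I$ for $z\in\mathbb{D}$. For $T_0,T_1\in C_\rho(H)$, $T_1$ is Harnack dominated by $T_0$ in $C_\rho(H)$ if there is a constant $c\ge 1$ with $K_z^\rho(T_1)\le c^2K_z^\rho(T_0)$ for all $z\in\mathbb{D}$. Finally, $\Gamma(T)=\sigma(T)\cap\mathbb{T}$. *)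

theory Defs
  imports "HOL-Analysis.Analysis"
begin

text \<open>
  Complex Hilbert spaces as a type class on top of \<^class>\<open>real_inner\<close>: the complex inner product is
  linear in the first argument, and its real part is the real inner product, so that norm, metric
  and topology are those induced by \<open>cinner\<close>.
\<close>

class complex_inner = real_inner +
  fixes scaleC :: "complex \<Rightarrow> 'a \<Rightarrow> 'a" (infixr "*\<^sub>C" 75)
    and cinner :: "'a \<Rightarrow> 'a \<Rightarrow> complex"
  assumes scaleC_add_right: "a *\<^sub>C (x + y) = a *\<^sub>C x + a *\<^sub>C y"
    and scaleC_add_left: "(a + b) *\<^sub>C x = a *\<^sub>C x + b *\<^sub>C x"
    and scaleC_scaleC: "a *\<^sub>C b *\<^sub>C x = (a * b) *\<^sub>C x"
    and scaleC_complex_of_real: "complex_of_real r *\<^sub>C x = r *\<^sub>R x"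
    and cinner_commute: "cinner x y = cnj (cinner y x)"
    and cinner_add_left: "cinner (x + y) z = cinner x z + cinner y z"
    and cinner_scaleC_left: "cinner (a *\<^sub>C x) y = a * cinner x y"
    and inner_eq_Re_cinner: "inner x y = Re (cinner x y)"

class chilbert_space = complex_inner + complete_space
begin
subclass banach ..
end

instantiation complex :: chilbert_space
begin

definition scaleC_complex :: "complex \<Rightarrow> complex \<Rightarrow> complex"
  where "scaleC_complex a x = a * x"

definition cinner_complex :: "complex \<Rightarrow> complex \<Rightarrow> complex"
  where "cinner_complex x y = x * cnj y"

instance
  by standard
    (auto simp: scaleC_complex_def cinner_complex_def algebra_simps inner_complex_def scaleR_conv_of_real)

end

definition bounded_clinear :: "('a::complex_inner \<Rightarrow> 'b::complex_inner) \<Rightarrow> bool"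
  where "bounded_clinear T \<longleftrightarrow> bounded_linear T \<and> (\<forall>a x. T (a *\<^sub>C x) = a *\<^sub>C T x)"

text \<open>On a Hilbert space the adjoint of a bounded operator exists (Riesz) and is unique.\<close>

definition cadjoint :: "('a::chilbert_space \<Rightarrow> 'b::chilbert_space) \<Rightarrow> 'b \<Rightarrow> 'a"
  where "cadjoint T = (THE S. \<forall>x y. cinner (T x) y = cinner x (S y))"

definition unitary_op :: "('a::chilbert_space \<Rightarrow> 'a) \<Rightarrow> bool"
  where "unitary_op U \<longleftrightarrow> bounded_clinear U \<and> cadjoint U \<circ> U = id \<and> U \<circ> cadjoint U = id"

definition op_inverse_of :: "('a::chilbert_space \<Rightarrow> 'a) \<Rightarrow> ('a \<Rightarrow> 'a) \<Rightarrow> bool"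
  where "op_inverse_of A S \<longleftrightarrow> bounded_clinear S \<and> A \<circ> S = id \<and> S \<circ> A = id"

definition op_inverse :: "('a::chilbert_space \<Rightarrow> 'a) \<Rightarrow> 'a \<Rightarrow> 'a"
  where "op_inverse A = (THE S. op_inverse_of A S)"

definition spectrum_op :: "('a::chilbert_space \<Rightarrow> 'a) \<Rightarrow> complex set"
  where "spectrum_op T = {l. \<not> (\<exists>S. op_inverse_of (\<lambda>x. l *\<^sub>C x - T x) S)}"

definition op_nonneg :: "('a::chilbert_space \<Rightarrow> 'a) \<Rightarrow> bool"
  where "op_nonneg A \<longleftrightarrow> (\<forall>x. cinner (A x) x \<in> \<real> \<and> 0 \<le> Re (cinner (A x) x))"

definition op_le :: "('a::chilbert_space \<Rightarrow> 'a) \<Rightarrow> ('a \<Rightarrow> 'a) \<Rightarrow> bool"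
  where "op_le A B \<longleftrightarrow> op_nonneg (\<lambda>x. B x - A x)"

definition orth_proj :: "'a::chilbert_space set \<Rightarrow> 'a \<Rightarrow> 'a"
  where "orth_proj M x = (THE y. y \<in> M \<and> (\<forall>m\<in>M. cinner (x - y) m = 0))"

text \<open>
  The inclusion of \<open>H\<close> as a closed subspace of the larger space \<open>K\<close> is rendered by a linear isometry
  \<open>J\<close> (whose range is closed because \<open>H\<close> is complete): \<open>H\<close> is identified with \<open>range J\<close>.
\<close>

definition isometric_embedding :: "('h::chilbert_space \<Rightarrow> 'k::chilbert_space) \<Rightarrow> bool"
  where "isometric_embedding J \<longleftrightarrow> bounded_clinear J \<and> (\<forall>x y. cinner (J x) (J y) = cinner x y)"

definition unitary_rho_dilation ::
    "real \<Rightarrow> ('h::chilbert_space \<Rightarrow> 'h) \<Rightarrow> ('h \<Rightarrow> 'k::chilbert_space) \<Rightarrow> ('k \<Rightarrow> 'k) \<Rightarrow> bool"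
  where "unitary_rho_dilation \<rho> T J U \<longleftrightarrow>
    isometric_embedding J \<and> unitary_op U \<and>
    (\<forall>n\<ge>1. \<forall>x. J ((T ^^ n) x) = \<rho> *\<^sub>R orth_proj (range J) ((U ^^ n) (J x)))"

text \<open>
  HOL cannot quantify existentially over types, so the type \<open>'k\<close> of the dilation space is a parameter.
  In a hypothesis \<open>T \<in> C_rho TYPE('k) \<rho>\<close> with \<open>'k\<close> a type variable not occurring in the conclusion,
  universal quantification over \<open>'k\<close> amounts to assuming a dilation on some Hilbert space.
  Operators lying in the class may be dilated on different spaces, hence need different variables.
\<close>

definition C_rho :: "'k::chilbert_space itself \<Rightarrow> real \<Rightarrow> ('h::chilbert_space \<Rightarrow> 'h) set"
  where "C_rho _ \<rho> = {T. bounded_clinear T \<and>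
    (\<exists>(J :: 'h \<Rightarrow> 'k) U. unitary_rho_dilation \<rho> T J U)}"

definition rho_kernel :: "real \<Rightarrow> complex \<Rightarrow> ('h::chilbert_space \<Rightarrow> 'h) \<Rightarrow> 'h \<Rightarrow> 'h"
  where "rho_kernel \<rho> z T = (\<lambda>x.
    op_inverse (\<lambda>y. y - cnj z *\<^sub>C T y) x
    + op_inverse (\<lambda>y. y - z *\<^sub>C cadjoint T y) x
    + (\<rho> - 2) *\<^sub>R x)"

text \<open>\<open>harnack_dominated \<rho> T1 T0\<close>: \<open>T1\<close> is dominated by \<open>T0\<close>; meaningful for operators in the class
  \<open>C_rho\<close>, for which the inverses in the kernels exist at every point of the open unit disc.\<close>

definition harnack_dominated ::
    "real \<Rightarrow> ('h::chilbert_space \<Rightarrow> 'h) \<Rightarrow> ('h \<Rightarrow> 'h) \<Rightarrow> bool"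
  where "harnack_dominated \<rho> T1 T0 \<longleftrightarrow>
    (\<exists>c::real. c \<ge> 1 \<and> (\<forall>z\<in>ball 0 1.
      op_le (rho_kernel \<rho> z T1) (\<lambda>x. c\<^sup>2 *\<^sub>R rho_kernel \<rho> z T0 x)))"

definition peripheral_spectrum :: "('h::chilbert_space \<Rightarrow> 'h) \<Rightarrow> complex set"
  where "peripheral_spectrum T = spectrum_op T \<inter> sphere 0 1"

end

theory Submission
  imports Defs
begin

text \<open>
  Write \<open>A = cnj \<lambda> T1\<close> for a unimodular \<open>\<lambda>\<close> outside the spectrum of \<open>T0\<close>. The inverses of
  \<open>1 - r cnj \<lambda> T0\<close> stay bounded as \<open>r\<close> increases to 1, so domination along the radius \<open>z = r \<lambda>\<close>
  bounds \<open>Re \<langle>(1 - r A)\<^sup>-\<^sup>1 x, x\<rangle>\<close> by a constant multiple of the square of the norm of \<open>x\<close>.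
  With \<open>x = y - r A y\<close> and \<open>y\<close> nearly fixed by \<open>A\<close>, this bound would compare a
  quantity of order \<open>1 - r\<close> with one of order \<open>(1 - r)\<^sup>2\<close>; hence \<open>1 - A\<close> is bounded below. As \<open>T1\<close> is
  power bounded, \<open>1 - r A\<close> is invertible for \<open>r < 1\<close>, with inverses bounded uniformly near \<open>r = 1\<close>,
  and a Neumann series argument shows that \<open>1 - A\<close> is invertible.
\<close>

subsection \<open>Complex inner product spaces\<close>

lemma cinner_add_right: "cinner x (y + z) = cinner x y + cinner x z"
  by (metis cinner_add_left cinner_commute complex_cnj_add)

lemma cinner_scaleC_right: "cinner x (a *\<^sub>C y) = cnj a * cinner x y"
  by (metis cinner_scaleC_left cinner_commute complex_cnj_mult)

lemma scaleC_minus1_left: "(- 1) *\<^sub>C x = - x"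
  using scaleC_complex_of_real[of "-1" x] by simp

lemma scaleC_one [simp]: "1 *\<^sub>C x = x"
  using scaleC_complex_of_real[of 1 x] by simp

lemma scaleC_zero_right [simp]: "a *\<^sub>C 0 = 0"
  using scaleC_add_right[of a 0 0] by simp

lemma scaleC_minus_right: "a *\<^sub>C (- x) = - (a *\<^sub>C x)"
  using scaleC_add_right[of a x "- x"] by (simp add: eq_neg_iff_add_eq_0 add.commute)

lemma scaleC_diff_right: "a *\<^sub>C (x - y) = a *\<^sub>C x - a *\<^sub>C y"
  using scaleC_add_right[of a x "- y"] by (simp add: scaleC_minus_right)

lemma scaleC_scaleR_commute: "a *\<^sub>C r *\<^sub>R x = r *\<^sub>R a *\<^sub>C x"
  by (metis mult.commute scaleC_complex_of_real scaleC_scaleC)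

lemma cinner_minus_left: "cinner (- x) y = - cinner x y"
  using cinner_scaleC_left[of "-1" x y] by (simp add: scaleC_minus1_left)

lemma cinner_diff_left: "cinner (x - y) z = cinner x z - cinner y z"
  using cinner_add_left[of x "- y" z] by (simp add: cinner_minus_left)

lemma cinner_diff_right: "cinner x (y - z) = cinner x y - cinner x z"
  by (metis cinner_diff_left cinner_commute complex_cnj_diff)

lemma cinner_scaleR_left: "cinner (r *\<^sub>R x) y = r * cinner x y"
  by (metis cinner_scaleC_left scaleC_complex_of_real)

lemma norm_scaleC: "norm (a *\<^sub>C x) = cmod a * norm x"
proof -
  have "cinner (a *\<^sub>C x) (a *\<^sub>C x) = (a * cnj a) * cinner x x"
    by (simp add: cinner_scaleC_left cinner_scaleC_right)
  then have "inner (a *\<^sub>C x) (a *\<^sub>C x) = (cmod a)\<^sup>2 * inner x x"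
    by (simp add: inner_eq_Re_cinner complex_mult_cnj cmod_power2)
  then have "(norm (a *\<^sub>C x))\<^sup>2 = (cmod a * norm x)\<^sup>2"
    by (simp add: power2_norm_eq_inner power_mult_distrib)
  then show ?thesis
    by (simp add: power2_eq_iff_nonneg)
qed

text \<open>The class fixes only the real part of \<open>cinner\<close> through
  \<open>inner\<close>. Rotation by \<open>\<i>\<close> recovers the imaginary part, which lets the
  real Riesz theorem yield complex adjoints.\<close>

lemma Im_cinner: "Im (cinner x y) = - inner (\<i> *\<^sub>C x) y"
  by (simp add: inner_eq_Re_cinner cinner_scaleC_left)

lemma cinner_eqI:
  assumes "\<And>x. cinner x y = cinner x z"
  shows "y = z"
proof -
  have "inner (y - z) (y - z) = 0"
    unfolding inner_eq_Re_cinner cinner_diff_right assms by simp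
  then show ?thesis by simp
qed

subsection \<open>Bounded operators and adjoints\<close>

lemma bounded_clinearI:
  assumes "\<And>x y. T (x + y) = T x + T y" "\<And>a x. T (a *\<^sub>C x) = a *\<^sub>C T x"
    "\<And>x. norm (T x) \<le> K * norm x"
  shows "bounded_clinear T"
proof -
  have "bounded_linear T"
  proof (rule bounded_linear_intro[where K = K])
    show "T (r *\<^sub>R x) = r *\<^sub>R T x" for r x
      using assms(2)[of "complex_of_real r" x] by (simp add: scaleC_complex_of_real)
    show "norm (T x) \<le> norm x * K" for x
      using assms(3)[of x] by (simp add: mult.commute)
  qed (rule assms)
  then show ?thesis by (simp add: bounded_clinear_def assms(2))
qed

lemma bounded_clinear_bounded_linear: "bounded_clinear T \<Longrightarrow> bounded_linear T"
  by (simp add: bounded_clinear_def)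

lemma bounded_clinear_scaleC: "bounded_clinear T \<Longrightarrow> T (a *\<^sub>C x) = a *\<^sub>C T x"
  by (simp add: bounded_clinear_def)

lemma bounded_clinear_add: "bounded_clinear T \<Longrightarrow> T (x + y) = T x + T y"
  by (simp add: bounded_clinear_def bounded_linear.linear linear_add)

lemma bounded_clinear_diff: "bounded_clinear T \<Longrightarrow> T (x - y) = T x - T y"
  by (simp add: bounded_clinear_def bounded_linear.linear linear_diff)

lemma bounded_clinear_pos_bound:
  assumes "bounded_clinear T"
  obtains K where "K > 0" "\<And>x. norm (T x) \<le> K * norm x"
  using bounded_linear.pos_bounded[OF bounded_clinear_bounded_linear[OF assms]]
  by (metis mult.commute)

lemma bounded_linear_scaleC: "bounded_linear (\<lambda>x. a *\<^sub>C x)"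
  by (rule bounded_linear_intro[where K = "cmod a"])
    (simp_all add: scaleC_add_right scaleC_scaleR_commute norm_scaleC mult.commute)

lemma bounded_clinear_compose_scaleC:
  assumes "bounded_clinear T"
  shows "bounded_clinear (\<lambda>x. a *\<^sub>C T x)"
  unfolding bounded_clinear_def
  using bounded_linear_compose[OF bounded_linear_scaleC bounded_clinear_bounded_linear[OF assms]]
  by (simp add: bounded_clinear_scaleC[OF assms] scaleC_scaleC mult.commute)

lemma bounded_clinear_compose:
  assumes "bounded_clinear T" "bounded_clinear S"
  shows "bounded_clinear (\<lambda>x. T (S x))"
  using assms unfolding bounded_clinear_def
  by (auto intro: bounded_linear_compose[of T S])

text \<open>The representing vector minimises \<open>\<parallel>x\<parallel>\<^sup>2 - 2 f x\<close>.\<close>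

lemma Riesz_representation:
  fixes f :: "'a::{real_inner,complete_space} \<Rightarrow> real"
  assumes "bounded_linear f"
  shows "\<exists>v. \<forall>x. f x = inner x v"
proof -
  interpret f: bounded_linear f by fact
  obtain K where K: "\<And>x. \<bar>f x\<bar> \<le> norm x * K"
    using f.bounded by auto
  define q where "q x = inner x x - 2 * f x" for x
  \<comment> \<open>Completing the square: \<open>q x\<close> is at least (norm x - K)^2 -
    K^2.\<close>
  have q_lower: "- K\<^sup>2 \<le> q x" for x
  proof -
    have "f x \<le> norm x * K" using K[of x] by linarith
    moreover have "0 \<le> (norm x - K)\<^sup>2" by simp
    ultimately show ?thesis
      unfolding q_def power2_norm_eq_inner[symmetric] by (simp add: power2_diff)
  qed
  define m where "m = Inf (range q)"
  have bdd: "bdd_below (range q)"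
    using q_lower by (auto simp: bdd_below_def)
  have m_le: "m \<le> q x" for x
    unfolding m_def by (rule cInf_lower[OF _ bdd]) simp
  have "\<exists>x. q x < m + inverse (real (Suc n))" for n
  proof (rule ccontr)
    assume "\<nexists>x. q x < m + inverse (real (Suc n))"
    then have "m + inverse (real (Suc n)) \<le> Inf (range q)"
      by (intro cInf_greatest) (auto simp: not_less)
    moreover have "0 < inverse (real (Suc n))" by simp
    ultimately show False unfolding m_def by linarith
  qed
  then obtain X where X: "\<And>n. q (X n) < m + inverse (real (Suc n))" by metis
  \<comment> \<open>The linear part of \<open>q\<close> cancels here, leaving the parallelogram law.
    As \<open>q\<close> at the midpoint is at least \<open>m\<close>, near-minimisers lie close
    together.\<close>
  have parallelogram: "(norm (x - y))\<^sup>2 = 2 * q x + 2 * q y - 4 * q ((1/2) *\<^sub>R (x + y))" for x y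
    unfolding q_def power2_norm_eq_inner
    by (simp add: f.add f.scaleR inner_add inner_diff inner_commute[of y x] algebra_simps)
  have "Cauchy X"
  proof (rule metric_CauchyI)
    fix e :: real assume "e > 0"
    \<comment> \<open>The four error terms, two for each of \<open>i\<close> and \<open>j\<close>,
      sum to at most 4/(N+1), hence the bound \<open>e\<^sup>2 / 4\<close>.\<close>
    then obtain N where N: "inverse (real (Suc N)) < e\<^sup>2 / 4"
      using reals_Archimedean[of "e\<^sup>2 / 4"] by auto
    have "dist (X i) (X j) < e" if "i \<ge> N" "j \<ge> N" for i j
    proof -
      have "inverse (real (Suc i)) \<le> inverse (real (Suc N))"
        "inverse (real (Suc j)) \<le> inverse (real (Suc N))"
        using that by (auto simp: field_simps)
      then have "(norm (X i - X j))\<^sup>2 < e\<^sup>2"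
        using parallelogram[of "X i" "X j"] X[of i] X[of j] N
          m_le[of "(1/2) *\<^sub>R (X i + X j)"] by linarith
      then show ?thesis
        using \<open>e > 0\<close> by (simp add: dist_norm power_less_imp_less_base)
    qed
    then show "\<exists>N. \<forall>i\<ge>N. \<forall>j\<ge>N. dist (X i) (X j) < e" by blast
  qed
  then obtain v where v: "X \<longlonglongrightarrow> v"
    using Cauchy_convergent_iff convergent_def by blast
  have "(\<lambda>n. q (X n)) \<longlonglongrightarrow> q v"
    unfolding q_def by (intro tendsto_intros f.tendsto v)
  moreover have "(\<lambda>n. m + inverse (real (Suc n))) \<longlonglongrightarrow> m + 0"
    by (intro tendsto_intros LIMSEQ_inverse_real_of_nat)
  ultimately have qv: "q v \<le> m"
    using X by (intro LIMSEQ_le[of _ "q v" _ m]) (auto intro: less_imp_le)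
  have "f h = inner h v" for h
  proof -
    \<comment> \<open>Half the first variation of \<open>q\<close> at \<open>v\<close> in direction
      \<open>h\<close>; minimality must make it vanish.\<close>
    define d where "d = inner h v - f h"
    define H where "H = inner h h"
    have "H \<ge> 0" by (simp add: H_def)
    have expand: "0 \<le> 2 * t * d + t\<^sup>2 * H" for t
      using order_trans[OF qv m_le[of "v + t *\<^sub>R h"]]
      by (simp add: q_def d_def H_def f.add f.scaleR inner_add inner_commute[of v h]
          power2_eq_square algebra_simps)
    \<comment> \<open>The minimising choice would be t = -d/H; using H + 1 in place of H avoids
      division by zero at h = 0 and still makes the right-hand side negative unless d = 0.\<close>
    have "0 \<le> - (2 * d\<^sup>2 / (H + 1)) + d\<^sup>2 * H / (H + 1)\<^sup>2"
      using expand[of "- d / (H + 1)"] by (simp add: power2_eq_square)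
    also have "\<dots> = - (d\<^sup>2 * (H + 2) / (H + 1)\<^sup>2)"
      using \<open>H \<ge> 0\<close> by (simp add: divide_simps) (simp add: power2_eq_square algebra_simps)
    finally have "d\<^sup>2 * (H + 2) / (H + 1)\<^sup>2 \<le> 0" by simp
    with \<open>H \<ge> 0\<close> have "d\<^sup>2 * (H + 2) \<le> 0"
      by (simp add: divide_le_0_iff)
    with \<open>H \<ge> 0\<close> have "d = 0"
      by (simp add: mult_le_0_iff)
    then show ?thesis by (simp add: d_def)
  qed
  then show ?thesis by blast
qed

lemma cadjoint_eqI:
  assumes "\<And>x y. cinner (T x) y = cinner x (S y)"
  shows "cadjoint T = S"
  unfolding cadjoint_def
proof (rule the_equality)
  show "\<forall>x y. cinner (T x) y = cinner x (S y)" using assms by simp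
  show "S' = S" if "\<forall>x y. cinner (T x) y = cinner x (S' y)" for S'
  proof
    show "S' y = S y" for y
      by (rule cinner_eqI) (metis that assms)
  qed
qed

text \<open>Riesz applied to the real functional \<open>inner (T x) y\<close> of x gives a candidate
  adjoint matching real parts; complex linearity of \<open>T\<close> transfers this to imaginary
  parts.\<close>

lemma cinner_cadjoint_right:
  fixes T :: "'a::chilbert_space \<Rightarrow> 'b::chilbert_space"
  assumes T: "bounded_clinear T"
  shows "cinner x (cadjoint T y) = cinner (T x) y"
proof -
  have "bounded_linear (\<lambda>x. inner (T x) y)" for y
    by (rule bounded_linear_compose[OF bounded_linear_inner_left
          bounded_clinear_bounded_linear[OF T]])
  then have "\<exists>v. \<forall>x. inner (T x) y = inner x v" for y
    by (rule Riesz_representation)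
  then obtain S where S: "\<And>x y. inner (T x) y = inner x (S y)" by metis
  have "cinner (T x) y = cinner x (S y)" for x y
  proof (rule complex_eqI)
    show "Re (cinner (T x) y) = Re (cinner x (S y))"
      using S[of x y] by (simp add: inner_eq_Re_cinner)
    show "Im (cinner (T x) y) = Im (cinner x (S y))"
      by (simp add: Im_cinner S[symmetric] bounded_clinear_scaleC[OF T])
  qed
  then show ?thesis using cadjoint_eqI[of T S] by simp
qed

lemma bounded_clinear_cadjoint:
  fixes T :: "'a::chilbert_space \<Rightarrow> 'b::chilbert_space"
  assumes T: "bounded_clinear T"
  shows "bounded_clinear (cadjoint T)"
proof -
  note adj = cinner_cadjoint_right[OF T]
  obtain K where K: "K > 0" "\<And>x. norm (T x) \<le> K * norm x"
    using bounded_clinear_pos_bound[OF T] by blast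
  show ?thesis
  proof (rule bounded_clinearI[where K = K])
    show "cadjoint T (x + y) = cadjoint T x + cadjoint T y" for x y
      by (rule cinner_eqI) (simp add: adj cinner_add_right)
    show "cadjoint T (a *\<^sub>C x) = a *\<^sub>C cadjoint T x" for a x
      by (rule cinner_eqI) (simp add: adj cinner_scaleC_right)
    show "norm (cadjoint T y) \<le> K * norm y" for y
    proof (cases "cadjoint T y = 0")
      case False
      have "norm (cadjoint T y) * norm (cadjoint T y) = inner (T (cadjoint T y)) y"
        by (simp add: norm_eq_sqrt_inner inner_eq_Re_cinner adj)
          (simp flip: inner_eq_Re_cinner adj)
      also have "\<dots> \<le> norm (T (cadjoint T y)) * norm y"
        by (rule norm_cauchy_schwarz)
      also have "\<dots> \<le> norm (cadjoint T y) * (K * norm y)"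
        using mult_right_mono[OF K(2)[of "cadjoint T y"], of "norm y"] by (simp add: mult_ac)
      finally show ?thesis using False by simp
    qed (use K in simp)
  qed
qed

section \<open>Dilations and power boundedness\<close>

text \<open>The projection onto the range of an isometry J is J J*, and Cauchy-Schwarz makes it
  contractive.\<close>

lemma norm_orth_proj_range_isometry:
  fixes J :: "'h::chilbert_space \<Rightarrow> 'k::chilbert_space"
  assumes J: "isometric_embedding J"
  shows "norm (orth_proj (range J) x) \<le> norm x"
proof -
  have bJ: "bounded_clinear J" and iso: "\<And>x y. cinner (J x) (J y) = cinner x y"
    using J by (auto simp: isometric_embedding_def)
  define p where "p = J (cadjoint J x)"
  have orth: "cinner (x - p) (J h) = 0" for h
  proof -
    have "cinner p (J h) = cnj (cinner h (cadjoint J x))"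
      by (simp add: p_def iso flip: cinner_commute)
    also have "\<dots> = cinner x (J h)"
      by (simp add: cinner_cadjoint_right[OF bJ] flip: cinner_commute)
    finally show ?thesis by (simp add: cinner_diff_left)
  qed
  have "orth_proj (range J) x = p"
    unfolding orth_proj_def
  proof (rule the_equality)
    show "p \<in> range J \<and> (\<forall>m\<in>range J. cinner (x - p) m = 0)"
      using orth by (auto simp: p_def)
    show "y = p" if y: "y \<in> range J \<and> (\<forall>m\<in>range J. cinner (x - y) m = 0)" for y
    proof -
      obtain g where g: "y = J g" using y by blast
      have "y - p \<in> range J"
        by (simp add: g p_def flip: bounded_clinear_diff[OF bJ])
      \<comment> \<open>Both residuals are orthogonal to \<open>y - p\<close>, which lies in the
        range; their difference is \<open>y - p\<close> itself, so it is orthogonal to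
        itself.\<close>
      then have "cinner (x - p) (y - p) - cinner (x - y) (y - p) = 0"
        using y orth by auto
      then have "cinner (y - p) (y - p) = 0"
        by (simp flip: cinner_diff_left)
      then have "inner (y - p) (y - p) = 0" by (simp add: inner_eq_Re_cinner)
      then show ?thesis by simp
    qed
  qed
  moreover have "norm p \<le> norm x"
  proof (cases "p = 0")
    case False
    have "inner (x - p) p = 0"
      using orth by (simp add: inner_eq_Re_cinner p_def)
    then have "norm p * norm p = inner x p"
      by (simp add: inner_diff_left flip: power2_norm_eq_inner power2_eq_square)
    also have "\<dots> \<le> norm x * norm p" by (rule norm_cauchy_schwarz)
    finally show ?thesis using False by simp
  qed simp
  ultimately show ?thesis by simp
qed

lemma norm_unitary_op:
  assumes U: "unitary_op U"
  shows "norm (U x) = norm x"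
proof -
  have bU: "bounded_clinear U" and inv: "cadjoint U (U x) = x"
    using U by (auto simp: unitary_op_def fun_eq_iff)
  have "cinner (U x) (U x) = cinner x x"
    by (simp add: inv flip: cinner_cadjoint_right[OF bU])
  then show ?thesis by (simp add: norm_eq_sqrt_inner inner_eq_Re_cinner)
qed

text \<open>In the dilation identity \<open>J\<close> and the powers of \<open>U\<close> are
  isometric and the projection is contractive, so only the factor \<rho> remains. The maximum with 1
  covers n = 0, about which the identity says nothing.\<close>

lemma C_rho_power_bounded:
  fixes T :: "'h::chilbert_space \<Rightarrow> 'h"
  assumes "T \<in> C_rho TYPE('k::chilbert_space) \<rho>"
  shows "norm ((T ^^ n) x) \<le> max 1 \<bar>\<rho>\<bar> * norm x"
proof (cases "n = 0")
  case True
  then show ?thesis using mult_right_mono[of 1 "max 1 \<bar>\<rho>\<bar>" "norm x"] by simp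
next
  case False
  obtain J :: "'h \<Rightarrow> 'k" and U where dil: "unitary_rho_dilation \<rho> T J U"
    using assms by (auto simp: C_rho_def)
  then have J: "isometric_embedding J" and U: "unitary_op U"
    and eq: "J ((T ^^ n) x) = \<rho> *\<^sub>R orth_proj (range J) ((U ^^ n) (J x))"
    using False by (auto simp: unitary_rho_dilation_def)
  have nJ: "norm (J y) = norm y" for y
    using J by (simp add: isometric_embedding_def norm_eq_sqrt_inner inner_eq_Re_cinner)
  have nU: "norm ((U ^^ k) y) = norm y" for k y
    by (induction k) (simp_all add: norm_unitary_op[OF U])
  have "norm ((T ^^ n) x) = \<bar>\<rho>\<bar> * norm (orth_proj (range J) ((U ^^ n) (J x)))"
    using arg_cong[OF eq, of norm] by (simp add: nJ)
  also have "\<dots> \<le> \<bar>\<rho>\<bar> * norm x"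
    using norm_orth_proj_range_isometry[OF J, of "(U ^^ n) (J x)"]
    by (intro mult_left_mono) (simp_all add: nJ nU)
  also have "\<dots> \<le> max 1 \<bar>\<rho>\<bar> * norm x"
    by (intro mult_right_mono) simp_all
  finally show ?thesis .
qed

subsection \<open>Inverses\<close>

lemma op_inverse_eqI:
  assumes "op_inverse_of A S"
  shows "op_inverse A = S"
  unfolding op_inverse_def
proof (rule the_equality[where P = "op_inverse_of A", OF assms])
  show "S' = S" if "op_inverse_of A S'" for S'
    using that assms by (auto simp: op_inverse_of_def fun_eq_iff) metis
qed

lemma op_inverse_of_right: "op_inverse_of A S \<Longrightarrow> A (S x) = x"
  by (auto simp: op_inverse_of_def fun_eq_iff)

lemma op_inverse_of_left: "op_inverse_of A S \<Longrightarrow> S (A x) = x"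
  by (auto simp: op_inverse_of_def fun_eq_iff)

lemma op_inverse_of_bounded_clinear: "op_inverse_of A S \<Longrightarrow> bounded_clinear S"
  by (auto simp: op_inverse_of_def)

lemma op_inverse_ofI:
  assumes "bounded_clinear S" "\<And>x. A (S x) = x" "\<And>x. S (A x) = x"
  shows "op_inverse_of A S"
  using assms by (auto simp: op_inverse_of_def fun_eq_iff)

lemma op_inverse_of_scaleC:
  assumes A: "op_inverse_of A S" and "a \<noteq> 0"
  shows "op_inverse_of (\<lambda>x. a *\<^sub>C A x) (\<lambda>x. inverse a *\<^sub>C S x)"
proof (rule op_inverse_ofI)
  have S: "bounded_clinear S" by (rule op_inverse_of_bounded_clinear[OF A])
  show "bounded_clinear (\<lambda>x. inverse a *\<^sub>C S x)"
    by (rule bounded_clinear_compose_scaleC[OF S])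
  have "A (inverse a *\<^sub>C S x) = inverse a *\<^sub>C x" for x
    by (simp add: op_inverse_of_right[OF A] flip: bounded_clinear_scaleC[OF S])
  then show "a *\<^sub>C A (inverse a *\<^sub>C S x) = x" for x
    using \<open>a \<noteq> 0\<close> by (simp add: scaleC_scaleC)
  show "inverse a *\<^sub>C S (a *\<^sub>C A x) = x" for x
    using \<open>a \<noteq> 0\<close> by (simp add: bounded_clinear_scaleC[OF S] op_inverse_of_left[OF A] scaleC_scaleC)
qed

text \<open>The geometric bound is on the powers, not on \<open>B\<close>, so that C > 1 is allowed;
  this suits multiples of power bounded operators.\<close>

lemma Neumann_series:
  fixes B :: "'a::chilbert_space \<Rightarrow> 'a"
  assumes B: "bounded_clinear B"
    and pow: "\<And>n x. norm ((B ^^ n) x) \<le> C * q ^ n * norm x" and q: "0 \<le> q" "q < 1"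
  shows "\<exists>S. op_inverse_of (\<lambda>x. x - B x) S"
proof -
  have linpow: "bounded_clinear (B ^^ n)" for n
  proof (induction n)
    case 0
    show ?case by (rule bounded_clinearI[where K = 1]) simp_all
  next
    case (Suc n)
    show ?case using bounded_clinear_compose[OF B Suc] by (simp add: o_def)
  qed
  define g where "g n = C * q ^ n" for n
  have sg: "summable g"
    unfolding g_def using q by (intro summable_mult summable_geometric) simp
  have sm: "summable (\<lambda>n. norm ((B ^^ n) x))" for x
    by (rule summable_comparison_test'[OF summable_mult2[OF sg, of "norm x"]])
      (use pow in \<open>simp add: g_def\<close>)
  then have sm': "summable (\<lambda>n. (B ^^ n) x)" for x
    by (rule summable_norm_cancel)
  define S where "S x = (\<Sum>n. (B ^^ n) x)" for x
  interpret B: bounded_linear B by (rule bounded_clinear_bounded_linear[OF B])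
  have SB: "S (B x) = B (S x)" for x
    unfolding S_def by (simp add: B.suminf[OF sm'] funpow_swap1)
  \<comment> \<open>Splitting off the term n = 0 gives the right inverse identity; commutation of
    \<open>S\<close> with \<open>B\<close> turns it into the left one.\<close>
  have BS: "S x = x + B (S x)" for x
    unfolding S_def B.suminf[OF sm'] using suminf_split_head[OF sm'[of x]] by simp
  have S_add: "S (x + y) = S x + S y" for x y
    by (simp add: S_def bounded_clinear_add[OF linpow] suminf_add[OF sm' sm'])
  have S_diff: "S (x - y) = S x - S y" for x y
    by (simp add: S_def bounded_clinear_diff[OF linpow] suminf_diff[OF sm' sm'])
  have "bounded_clinear S"
  proof (rule bounded_clinearI[where K = "suminf g"])
    show "S (x + y) = S x + S y" for x y by (rule S_add)
    show "S (a *\<^sub>C x) = a *\<^sub>C S x" for a x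
      by (simp add: S_def bounded_clinear_scaleC[OF linpow]
          bounded_linear.suminf[OF bounded_linear_scaleC sm'])
    show "norm (S x) \<le> suminf g * norm x" for x
    proof -
      have "norm (S x) \<le> (\<Sum>n. norm ((B ^^ n) x))"
        unfolding S_def by (rule summable_norm[OF sm])
      also have "\<dots> \<le> (\<Sum>n. g n * norm x)"
        by (rule suminf_le[OF _ sm summable_mult2[OF sg]]) (use pow in \<open>simp add: g_def\<close>)
      also have "\<dots> = suminf g * norm x" by (rule suminf_mult2[OF sg, symmetric])
      finally show ?thesis .
    qed
  qed
  then have "op_inverse_of (\<lambda>x. x - B x) S"
  proof (rule op_inverse_ofI)
    show "S x - B (S x) = x" for x using BS[of x] by (metis add_diff_cancel_right')
    then show "S (x - B x) = x" for x by (simp add: S_diff SB)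
  qed
  then show ?thesis by blast
qed

text \<open>Factor A - E = (1 - E S) A. Since E S has norm at most e M < 1, the first factor is
  inverted by a Neumann series, and the inverse sought is S (1 - E S)^(-1).\<close>

lemma op_inverse_of_perturbation:
  fixes A :: "'a::chilbert_space \<Rightarrow> 'a"
  assumes A: "op_inverse_of A S" and E: "bounded_clinear E"
    and S: "\<And>x. norm (S x) \<le> M * norm x" and small: "\<And>x. norm (E x) \<le> e * norm x"
    and "0 \<le> e" "0 \<le> M" "e * M < 1"
  shows "\<exists>R. op_inverse_of (\<lambda>x. A x - E x) R"
proof -
  have bS: "bounded_clinear S" by (rule op_inverse_of_bounded_clinear[OF A])
  define F where "F x = E (S x)" for x
  have F: "bounded_clinear F"
    unfolding F_def by (rule bounded_clinear_compose[OF E bS])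
  have F_le: "norm (F x) \<le> (e * M) * norm x" for x
    using order_trans[OF small[of "S x"] mult_left_mono[OF S[of x] \<open>0 \<le> e\<close>]]
    by (simp add: F_def mult.assoc)
  have "norm ((F ^^ n) x) \<le> 1 * (e * M) ^ n * norm x" for n x
  proof (induction n)
    case (Suc n)
    have "norm ((F ^^ Suc n) x) \<le> (e * M) * norm ((F ^^ n) x)"
      using F_le by simp
    also have "\<dots> \<le> (e * M) * (1 * (e * M) ^ n * norm x)"
      using Suc assms by (intro mult_left_mono) auto
    finally show ?case by (simp add: mult_ac)
  qed simp
  then obtain G where G: "op_inverse_of (\<lambda>x. x - F x) G"
    using Neumann_series[OF F, of 1 "e * M"] assms by auto
  have "op_inverse_of (\<lambda>x. A x - E x) (\<lambda>x. S (G x))"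
  proof (rule op_inverse_ofI)
    show "bounded_clinear (\<lambda>x. S (G x))"
      by (rule bounded_clinear_compose[OF bS op_inverse_of_bounded_clinear[OF G]])
    show "A (S (G x)) - E (S (G x)) = x" for x
      using op_inverse_of_right[OF G, of x] by (simp add: op_inverse_of_right[OF A] F_def)
    show "S (G (A x - E x)) = x" for x
      using op_inverse_of_left[OF G, of "A x"] by (simp add: op_inverse_of_left[OF A] F_def)
  qed
  then show ?thesis by blast
qed

section \<open>Spectrum and kernel in terms of resolvents\<close>

text \<open>For unimodular l the operators l - T and 1 - cnj l T differ by an invertible scalar. The
  second form is the boundary case of the operators inverted in the kernel.\<close>

lemma notin_spectrum_op_iff:
  assumes "bounded_clinear T" "cmod l = 1"
  shows "l \<notin> spectrum_op T \<longleftrightarrow> (\<exists>S. op_inverse_of (\<lambda>x. x - cnj l *\<^sub>C T x) S)"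
proof -
  have l: "l * cnj l = 1" "cnj l * l = 1" "l \<noteq> 0"
    using assms(2) complex_norm_square[of l] by (auto simp: mult.commute)
  have eq: "(\<lambda>x. x - cnj l *\<^sub>C T x) = (\<lambda>x. cnj l *\<^sub>C (l *\<^sub>C x - T x))"
    "(\<lambda>x. l *\<^sub>C x - T x) = (\<lambda>x. l *\<^sub>C (x - cnj l *\<^sub>C T x))"
    by (simp_all add: scaleC_diff_right scaleC_scaleC l)
  show ?thesis
    unfolding spectrum_op_def mem_Collect_eq not_not
  proof
    assume "\<exists>S. op_inverse_of (\<lambda>x. l *\<^sub>C x - T x) S"
    then show "\<exists>S. op_inverse_of (\<lambda>x. x - cnj l *\<^sub>C T x) S"
      unfolding eq(1) using op_inverse_of_scaleC[of _ _ "cnj l"] l(3) by fastforce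
  next
    assume "\<exists>S. op_inverse_of (\<lambda>x. x - cnj l *\<^sub>C T x) S"
    then show "\<exists>S. op_inverse_of (\<lambda>x. l *\<^sub>C x - T x) S"
      unfolding eq(2) using op_inverse_of_scaleC[of _ _ l] l(3) by fastforce
  qed
qed

text \<open>The second inverse in the kernel is the adjoint of the first, so both contribute the
  same real part.\<close>

lemma Re_cinner_rho_kernel:
  fixes T :: "'h::chilbert_space \<Rightarrow> 'h"
  assumes T: "bounded_clinear T" and R: "op_inverse_of (\<lambda>y. y - cnj z *\<^sub>C T y) R"
  shows "Re (cinner (rho_kernel \<rho> z T x) x) = 2 * inner (R x) x + (\<rho> - 2) * (norm x)\<^sup>2"
proof -
  have bR: "bounded_clinear R" by (rule op_inverse_of_bounded_clinear[OF R])
  note adjT = cinner_cadjoint_right[OF T] and adjR = cinner_cadjoint_right[OF bR]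
  have "op_inverse_of (\<lambda>y. y - z *\<^sub>C cadjoint T y) (cadjoint R)"
  proof (rule op_inverse_ofI)
    show "bounded_clinear (cadjoint R)" by (rule bounded_clinear_cadjoint[OF bR])
    \<comment> \<open>1 - z T* is the adjoint of 1 - cnj z T. The right inverse identity for the
      adjoint of \<open>R\<close> thus comes from the left one for \<open>R\<close>, and
      conversely.\<close>
    have shift: "cinner w (y - z *\<^sub>C cadjoint T y) = cinner (w - cnj z *\<^sub>C T w) y" for w y
      by (simp add: cinner_diff_left cinner_diff_right cinner_scaleC_left cinner_scaleC_right adjT)
    show "cadjoint R y - z *\<^sub>C cadjoint T (cadjoint R y) = y" for y
      by (rule cinner_eqI) (simp only: shift adjR op_inverse_of_left[OF R])
    show "cadjoint R (y - z *\<^sub>C cadjoint T y) = y" for y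
      by (rule cinner_eqI) (simp only: shift adjR op_inverse_of_right[OF R])
  qed
  then have "rho_kernel \<rho> z T x = R x + cadjoint R x + (\<rho> - 2) *\<^sub>R x"
    using op_inverse_eqI[OF R] op_inverse_eqI by (fastforce simp: rho_kernel_def)
  moreover have "inner (cadjoint R x) x = inner (R x) x"
    unfolding inner_commute[of "cadjoint R x"] by (simp add: inner_eq_Re_cinner adjR)
  ultimately show ?thesis
    by (simp add: power2_norm_eq_inner inner_add_left flip: inner_eq_Re_cinner)
qed

section \<open>Inverses along a radius\<close>

text \<open>Moving from l to r l perturbs 1 - cnj l T by an operator of size |r - 1|.\<close>

lemma radial_op_diff:
  "x - cnj (complex_of_real r * l) *\<^sub>C T x =
    (x - cnj l *\<^sub>C T x) - complex_of_real (r - 1) *\<^sub>C cnj l *\<^sub>C T x"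
proof -
  have "cnj (complex_of_real r * l) *\<^sub>C T x =
    (1 + complex_of_real (r - 1)) *\<^sub>C cnj l *\<^sub>C T x"
    by (simp add: scaleC_scaleC)
  then show ?thesis unfolding scaleC_add_left by simp
qed

text \<open>Invertibility at the boundary point survives small inward moves, with one bound for all
  inverses: the perturbation has norm at most s K.\<close>

lemma radial_inverse_bounded:
  fixes T :: "'h::chilbert_space \<Rightarrow> 'h"
  assumes T: "bounded_clinear T" and l: "cmod l = 1" and S: "op_inverse_of (\<lambda>x. x - cnj l *\<^sub>C T x) S"
  shows "\<exists>M s0. M > 0 \<and> s0 > 0 \<and> (\<forall>s. 0 < s \<and> s < s0 \<longrightarrow>
    (\<exists>R. op_inverse_of (\<lambda>x. x - cnj (complex_of_real (1 - s) * l) *\<^sub>C T x) R \<and>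
      (\<forall>x. norm (R x) \<le> M * norm x)))"
proof -
  obtain N where N: "N > 0" "\<And>x. norm (S x) \<le> N * norm x"
    using bounded_clinear_pos_bound[OF op_inverse_of_bounded_clinear[OF S]] by blast
  obtain K where K: "K > 0" "\<And>x. norm (T x) \<le> K * norm x"
    using bounded_clinear_pos_bound[OF T] by blast
  \<comment> \<open>The threshold for s makes s K N < 1/2: this permits the perturbation and lets
    half of the norm of \<open>R x\<close> be absorbed, whence the bound 2 N.\<close>
  have "\<exists>R. op_inverse_of (\<lambda>x. x - cnj (complex_of_real (1 - s) * l) *\<^sub>C T x) R \<and>
      (\<forall>x. norm (R x) \<le> 2 * N * norm x)" if s: "0 < s" "s < 1 / (2 * N * K)" for s
  proof -
    define E where "E x = complex_of_real (- s) *\<^sub>C cnj l *\<^sub>C T x" for x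
    have E: "bounded_clinear E"
      unfolding E_def by (intro bounded_clinear_compose_scaleC T)
    have E_le: "norm (E x) \<le> (s * K) * norm x" for x
      using mult_left_mono[OF K(2)[of x], of s] s l by (simp add: E_def norm_scaleC)
    have half: "s * K * N < 1 / 2"
      using s N(1) K(1) by (simp add: field_simps)
    have eq: "(\<lambda>x. x - cnj (complex_of_real (1 - s) * l) *\<^sub>C T x) = (\<lambda>x. (x - cnj l *\<^sub>C T x) - E x)"
      unfolding E_def radial_op_diff by simp
    obtain R where R: "op_inverse_of (\<lambda>x. (x - cnj l *\<^sub>C T x) - E x) R"
      using op_inverse_of_perturbation[OF S E N(2) E_le] s(1) N(1) K(1) half by auto
    have "norm (R x) \<le> 2 * N * norm x" for x
    proof -
      have "R x - cnj l *\<^sub>C T (R x) = x + E (R x)"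
        using op_inverse_of_right[OF R, of x] by (simp add: diff_eq_eq)
      then have "R x = S (x + E (R x))"
        using op_inverse_of_left[OF S, of "R x"] by simp
      then have "norm (R x) \<le> N * norm (x + E (R x))" using N(2) by metis
      also have "\<dots> \<le> N * (norm x + (s * K) * norm (R x))"
        using N(1) norm_triangle_ineq[of x "E (R x)"] E_le[of "R x"] by (intro mult_left_mono) auto
      also have "\<dots> = N * norm x + (s * K * N) * norm (R x)" by (simp add: algebra_simps)
      also have "\<dots> \<le> N * norm x + (1 / 2) * norm (R x)"
        using half by (intro add_left_mono mult_right_mono) auto
      finally show ?thesis by simp
    qed
    then show ?thesis using R eq by auto
  qed
  moreover have "2 * N > 0" "1 / (2 * N * K) > 0" using N(1) K(1) by auto
  ultimately show ?thesis by blast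
qed

text \<open>The powers of a T decay like |a|^n, up to the constant C.\<close>

lemma power_bounded_radial_inverse:
  fixes T :: "'h::chilbert_space \<Rightarrow> 'h"
  assumes T: "bounded_clinear T" and pow: "\<And>n x. norm ((T ^^ n) x) \<le> C * norm x" and a: "cmod a < 1"
  shows "\<exists>R. op_inverse_of (\<lambda>x. x - a *\<^sub>C T x) R"
proof (rule Neumann_series[where C = C and q = "cmod a"])
  have "((\<lambda>x. a *\<^sub>C T x) ^^ n) x = (a ^ n) *\<^sub>C (T ^^ n) x" for n x
    by (induction n) (simp_all add: bounded_clinear_scaleC[OF T] scaleC_scaleC mult.commute)
  then show "norm (((\<lambda>x. a *\<^sub>C T x) ^^ n) x) \<le> C * cmod a ^ n * norm x" for n x
    using mult_left_mono[OF pow[of n x], of "cmod a ^ n"]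
    by (simp add: norm_scaleC norm_power mult_ac)
qed (use a bounded_clinear_compose_scaleC[OF T] in auto)

subsection \<open>Domination and the peripheral spectrum\<close>

text \<open>One small s suffices. If w = y - A y were small against s y, then y - (1 - s) A y = s y
  + (1 - s) w would be close to s y, and the hypothesis would bound about 2 s |y|^2 by about C s^2
  |y|^2.\<close>

lemma bounded_below_of_radial_bound:
  fixes A :: "'a::real_inner \<Rightarrow> 'a"
  assumes s0: "s0 > 0" and C: "C \<ge> 0"
    and bound: "\<And>s y. \<lbrakk>0 < s; s < s0\<rbrakk> \<Longrightarrow>
      2 * inner y (y - (1 - s) *\<^sub>R A y) \<le> C * (norm (y - (1 - s) *\<^sub>R A y))\<^sup>2"
  shows "\<exists>d>0. \<forall>y. d * norm y \<le> norm (y - A y)"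
proof -
  \<comment> \<open>Halving \<open>s0\<close> gives strict inequality, the bound 1 keeps 1 - s
    nonnegative, and the last term gives 2 C s \<le> 1; C + 1 allows C = 0.\<close>
  define s where "s = min (min (s0 / 2) 1) (1 / (2 * (C + 1)))"
  have s: "0 < s" "s < s0" "s \<le> 1" using s0 C by (auto simp: s_def)
  have "s \<le> 1 / (2 * (C + 1))" by (simp add: s_def)
  then have "s * (2 * (C + 1)) \<le> 1" using C by (simp add: pos_le_divide_eq)
  then have Cs: "2 * (C * s) \<le> 1" using s by (simp add: algebra_simps)
  \<comment> \<open>With |w| < s |y| / 4 the vector s y + (1 - s) w has norm at most 5/4 s |y|, and
    its inner product with y is at least 3/4 s |y|^2.\<close>
  have "s / 4 * norm y \<le> norm (y - A y)" for y
  proof (rule ccontr)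
    define w where "w = y - A y"
    assume "\<not> s / 4 * norm y \<le> norm (y - A y)"
    then have w: "norm w < s / 4 * norm y" by (simp add: w_def)
    define Y where "Y = norm y"
    have Y: "Y > 0"
    proof (rule ccontr)
      assume "\<not> Y > 0"
      then show False using w norm_ge_zero[of w] by (simp add: Y_def)
    qed
    have split: "y - (1 - s) *\<^sub>R A y = s *\<^sub>R y + (1 - s) *\<^sub>R w"
      by (simp add: w_def algebra_simps)
    have "norm (s *\<^sub>R y + (1 - s) *\<^sub>R w) \<le> s * Y + (1 - s) * norm w"
      using norm_triangle_ineq[of "s *\<^sub>R y" "(1 - s) *\<^sub>R w"] s by (simp add: Y_def)
    also have "\<dots> \<le> s * Y + norm w"
      using s mult_right_mono[of "1 - s" 1 "norm w"] by simp
    also have "\<dots> \<le> (5 / 4) * (s * Y)" using w by (simp add: Y_def)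
    finally have upper: "(norm (s *\<^sub>R y + (1 - s) *\<^sub>R w))\<^sup>2 \<le> ((5 / 4) * (s * Y))\<^sup>2"
      by (rule power_mono) simp
    have "\<bar>inner y w\<bar> \<le> Y * norm w" using Cauchy_Schwarz_ineq2[of y w] by (simp add: Y_def)
    also have "\<dots> \<le> Y * (s / 4 * Y)"
      using w Y by (intro mult_left_mono) (auto simp: Y_def)
    finally have "(1 - s) * \<bar>inner y w\<bar> \<le> 1 * (Y * (s / 4 * Y))"
      using s by (intro mult_mono) auto
    moreover have "- ((1 - s) * \<bar>inner y w\<bar>) \<le> (1 - s) * inner y w"
      using s mult_left_mono[of "- \<bar>inner y w\<bar>" "inner y w" "1 - s"] by simp
    moreover have "inner y (s *\<^sub>R y + (1 - s) *\<^sub>R w) = s * Y\<^sup>2 + (1 - s) * inner y w"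
      by (simp add: inner_add_right Y_def power2_norm_eq_inner)
    moreover have "1 * (Y * (s / 4 * Y)) = s * Y\<^sup>2 / 4"
      by (simp add: power2_eq_square)
    ultimately have "s * Y\<^sup>2 - s * Y\<^sup>2 / 4 \<le> inner y (s *\<^sub>R y + (1 - s) *\<^sub>R w)"
      by linarith
    then have "3 / 2 * (s * Y\<^sup>2) \<le> 2 * inner y (s *\<^sub>R y + (1 - s) *\<^sub>R w)" by simp
    also have "\<dots> \<le> C * (norm (s *\<^sub>R y + (1 - s) *\<^sub>R w))\<^sup>2"
      using bound[OF s(1,2), of y] by (simp only: split)
    also have "\<dots> \<le> C * ((5 / 4) * (s * Y))\<^sup>2"
      using upper C by (rule mult_left_mono)
    \<comment> \<open>Isolating 2 C s \<le> 1 leaves 3/2 \<le> 25/32 after division by s |y|^2 > 0,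
      which is absurd.\<close>
    also have "\<dots> = 25 / 32 * ((2 * (C * s)) * (s * Y\<^sup>2))"
      by (simp add: power2_eq_square)
    also have "\<dots> \<le> 25 / 32 * (1 * (s * Y\<^sup>2))"
      using Cs s by (intro mult_left_mono mult_right_mono) auto
    finally show False using s Y by (simp add: mult_le_0_iff)
  qed
  then show ?thesis using s by (intro exI[of _ "s / 4"]) auto
qed

text \<open>The kernels at z = (1 - s) l are tested on x = y - cnj z T1 y, which the inverse for
  \<open>T1\<close> sends back to y. The side of \<open>T0\<close> is controlled by its uniformly
  bounded radial inverses.\<close>

lemma harnack_dominated_radial_bound:
  fixes T0 T1 :: "'h::chilbert_space \<Rightarrow> 'h"
  assumes T0: "bounded_clinear T0" and T1: "bounded_clinear T1"
    and dom: "harnack_dominated \<rho> T1 T0" and l: "cmod l = 1" and l0: "l \<notin> spectrum_op T0"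
    and inv1: "\<And>z. cmod z < 1 \<Longrightarrow> \<exists>R. op_inverse_of (\<lambda>x. x - cnj z *\<^sub>C T1 x) R"
  shows "\<exists>s0 C. s0 > 0 \<and> C \<ge> 0 \<and> (\<forall>s y. 0 < s \<and> s < s0 \<longrightarrow>
    2 * inner y (y - (1 - s) *\<^sub>R cnj l *\<^sub>C T1 y) \<le> C * (norm (y - (1 - s) *\<^sub>R cnj l *\<^sub>C T1 y))\<^sup>2)"
proof -
  obtain c where le: "\<And>z. z \<in> ball 0 1 \<Longrightarrow>
      op_le (rho_kernel \<rho> z T1) (\<lambda>x. c\<^sup>2 *\<^sub>R rho_kernel \<rho> z T0 x)"
    using dom unfolding harnack_dominated_def by blast
  obtain S where "op_inverse_of (\<lambda>x. x - cnj l *\<^sub>C T0 x) S"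
    using l0 notin_spectrum_op_iff[OF T0 l] by blast
  from radial_inverse_bounded[OF T0 l this] obtain M s0 where M: "M > 0" "s0 > 0"
    and bdd: "\<And>s. \<lbrakk>0 < s; s < s0\<rbrakk> \<Longrightarrow>
      \<exists>R. op_inverse_of (\<lambda>x. x - cnj (complex_of_real (1 - s) * l) *\<^sub>C T0 x) R \<and>
        (\<forall>x. norm (R x) \<le> M * norm x)"
    by blast
  \<comment> \<open>The first summand bounds the kernel form of \<open>T0\<close>; the second pays
    for moving the term with \<rho> - 2 of \<open>T1\<close> across. Absolute values appear because
    \<rho> - 2 may have either sign.\<close>
  define C where "C = c\<^sup>2 * (2 * M + \<bar>\<rho> - 2\<bar>) + \<bar>\<rho> - 2\<bar>"
  have C: "C \<ge> 0" using M by (simp add: C_def)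
  have "2 * inner y (y - (1 - s) *\<^sub>R cnj l *\<^sub>C T1 y) \<le> C * (norm (y - (1 - s) *\<^sub>R cnj l *\<^sub>C T1 y))\<^sup>2"
    if s: "0 < s" "s < min s0 1" for s y
  proof -
    define z where "z = complex_of_real (1 - s) * l"
    have z: "cmod z < 1" using s l unfolding z_def norm_mult norm_of_real by simp
    obtain R0 where R0: "op_inverse_of (\<lambda>x. x - cnj z *\<^sub>C T0 x) R0"
      and R0_le: "\<And>x. norm (R0 x) \<le> M * norm x"
      using bdd[of s] s unfolding z_def by auto
    obtain R1 where R1: "op_inverse_of (\<lambda>x. x - cnj z *\<^sub>C T1 x) R1"
      using inv1[OF z] by blast
    define x where "x = y - (1 - s) *\<^sub>R cnj l *\<^sub>C T1 y"
    have "cnj z *\<^sub>C T1 y = (1 - s) *\<^sub>R cnj l *\<^sub>C T1 y"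
      by (simp add: z_def scaleC_scaleC flip: scaleC_complex_of_real)
    then have R1x: "R1 x = y"
      using op_inverse_of_left[OF R1, of y] by (simp add: x_def)
    define X where "X = (norm x)\<^sup>2"
    have "X \<ge> 0" by (simp add: X_def)
    have "0 \<le> Re (cinner (c\<^sup>2 *\<^sub>R rho_kernel \<rho> z T0 x - rho_kernel \<rho> z T1 x) x)"
      using le[of z] z by (simp add: op_le_def op_nonneg_def)
    then have "Re (cinner (rho_kernel \<rho> z T1 x) x) \<le> c\<^sup>2 * Re (cinner (rho_kernel \<rho> z T0 x) x)"
      by (simp add: cinner_diff_left cinner_scaleR_left)
    then have main: "2 * inner y x + (\<rho> - 2) * X \<le> c\<^sup>2 * (2 * inner (R0 x) x + (\<rho> - 2) * X)"
      by (simp add: Re_cinner_rho_kernel[OF T1 R1] Re_cinner_rho_kernel[OF T0 R0] R1x X_def)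
    have "inner (R0 x) x \<le> norm (R0 x) * norm x" by (rule norm_cauchy_schwarz)
    also have "\<dots> \<le> M * X"
      using mult_right_mono[OF R0_le[of x], of "norm x"] by (simp add: X_def power2_eq_square mult.assoc)
    finally have "inner (R0 x) x \<le> M * X" .
    moreover have rho: "(\<rho> - 2) * X \<le> \<bar>\<rho> - 2\<bar> * X" "- (\<bar>\<rho> - 2\<bar> * X) \<le> (\<rho> - 2) * X"
      using \<open>X \<ge> 0\<close> mult_right_mono[of "\<rho> - 2" "\<bar>\<rho> - 2\<bar>" X]
        mult_right_mono[of "- \<bar>\<rho> - 2\<bar>" "\<rho> - 2" X] by auto
    ultimately have "2 * inner (R0 x) x + (\<rho> - 2) * X \<le> (2 * M + \<bar>\<rho> - 2\<bar>) * X"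
      by (simp add: algebra_simps)
    then have "c\<^sup>2 * (2 * inner (R0 x) x + (\<rho> - 2) * X) \<le> c\<^sup>2 * ((2 * M + \<bar>\<rho> - 2\<bar>) * X)"
      by (rule mult_left_mono) simp
    with main rho have "2 * inner y x \<le> c\<^sup>2 * ((2 * M + \<bar>\<rho> - 2\<bar>) * X) + \<bar>\<rho> - 2\<bar> * X"
      by linarith
    also have "\<dots> = C * X" by (simp add: C_def algebra_simps)
    finally show ?thesis by (simp add: x_def X_def)
  qed
  moreover have "min s0 1 > 0" using M by simp
  ultimately show ?thesis using C by blast
qed

text \<open>A lower bound alone does not give surjectivity; that comes from a nearby radial inverse.
  The lower bound controls its norm by 2/d, so the perturbation back to the circle, of norm at most
  d/4, has product 1/2 < 1 with it.\<close>

lemma invertible_of_bounded_below_radial: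
  fixes T :: "'h::chilbert_space \<Rightarrow> 'h"
  assumes T: "bounded_clinear T" and l: "cmod l = 1"
    and inv: "\<And>z. cmod z < 1 \<Longrightarrow> \<exists>R. op_inverse_of (\<lambda>x. x - cnj z *\<^sub>C T x) R"
    and d: "d > 0" "\<And>y. d * norm y \<le> norm (y - cnj l *\<^sub>C T y)"
  shows "\<exists>S. op_inverse_of (\<lambda>x. x - cnj l *\<^sub>C T x) S"
proof -
  obtain K where K: "K > 0" "\<And>x. norm (T x) \<le> K * norm x"
    using bounded_clinear_pos_bound[OF T] by blast
  \<comment> \<open>Chosen so that s K \<le> d/4 and the point (1 - s) l stays in the disc.\<close>
  define s where "s = min (1 / 2) (d / (4 * K))"
  have s: "0 < s" "s < 1" using K d by (auto simp: s_def)
  have "s \<le> d / (4 * K)" by (simp add: s_def)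
  then have sK: "s * K \<le> d / 4" using K by (simp add: field_simps)
  define z where "z = complex_of_real (1 - s) * l"
  have "cmod z < 1" using s l unfolding z_def norm_mult norm_of_real by simp
  then obtain R where R: "op_inverse_of (\<lambda>x. x - cnj z *\<^sub>C T x) R"
    using inv by blast
  define E where "E x = complex_of_real s *\<^sub>C cnj l *\<^sub>C T x" for x
  have E: "bounded_clinear E"
    unfolding E_def by (intro bounded_clinear_compose_scaleC T)
  have E_le: "norm (E x) \<le> (d / 4) * norm x" for x
  proof -
    have "norm (E x) \<le> (s * K) * norm x"
      using mult_left_mono[OF K(2)[of x], of s] s l by (simp add: E_def norm_scaleC)
    also have "\<dots> \<le> (d / 4) * norm x" using sK by (rule mult_right_mono) simp
    finally show ?thesis .
  qed
  have eq: "x - cnj z *\<^sub>C T x = (x - cnj l *\<^sub>C T x) + E x" for x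
    unfolding z_def radial_op_diff E_def
    by (simp add: scaleC_complex_of_real del: of_real_minus of_real_diff)
  have R_le: "norm (R x) \<le> (2 / d) * norm x" for x
  proof -
    have "x = (R x - cnj l *\<^sub>C T (R x)) + E (R x)"
      using op_inverse_of_right[OF R, of x] by (simp only: eq)
    then have "norm (R x - cnj l *\<^sub>C T (R x)) \<le> norm x + norm (E (R x))"
      by (metis add_diff_cancel_right' norm_triangle_ineq4)
    \<comment> \<open>The lower bound is applied to \<open>R x\<close>, and a quarter of d |R x| is
      absorbed.\<close>
    with d(2)[of "R x"] E_le[of "R x"] have "d * norm (R x) \<le> norm x + (d / 4) * norm (R x)"
      by linarith
    then have "d * norm (R x) \<le> 2 * norm x"
      using norm_ge_zero[of x] by linarith
    then show ?thesis using d by (simp add: field_simps)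
  qed
  have "\<exists>S. op_inverse_of (\<lambda>x. (x - cnj z *\<^sub>C T x) - E x) S"
    using d by (intro op_inverse_of_perturbation[OF R E R_le E_le]) auto
  then show ?thesis by (simp add: eq)
qed

theorem theorem2p1:
  fixes \<rho> :: real
    and T0 T1 :: "'h::chilbert_space \<Rightarrow> 'h"
  assumes "\<rho> \<ge> 1"
    and "T0 \<in> C_rho TYPE('k0::chilbert_space) \<rho>"
    and "T1 \<in> C_rho TYPE('k1::chilbert_space) \<rho>"
    and "harnack_dominated \<rho> T1 T0"
  shows "peripheral_spectrum T1 \<subseteq> peripheral_spectrum T0"
proof
  fix l assume l1: "l \<in> peripheral_spectrum T1"
  then have l: "cmod l = 1" by (simp add: peripheral_spectrum_def)
  have T0: "bounded_clinear T0" and T1: "bounded_clinear T1"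
    using assms(2,3) by (auto simp: C_rho_def)
  \<comment> \<open>The dilation of \<open>T1\<close> enters only here, through power
    boundedness.\<close>
  have inv: "\<exists>R. op_inverse_of (\<lambda>x. x - cnj z *\<^sub>C T1 x) R" if "cmod z < 1" for z
    using power_bounded_radial_inverse[OF T1 C_rho_power_bounded[OF assms(3)], of "cnj z"] that
    by simp
  have "l \<in> spectrum_op T0"
  proof (rule ccontr)
    assume "l \<notin> spectrum_op T0"
    \<comment> \<open>From regularity of \<open>T0\<close> at l, domination gives the radial bound,
      then the lower bound and finally invertibility for \<open>T1\<close>, contradicting the choice
      of l.\<close>
    then obtain s0 C where "s0 > 0" "C \<ge> 0" "\<And>s y. \<lbrakk>0 < s; s < s0\<rbrakk> \<Longrightarrow>
      2 * inner y (y - (1 - s) *\<^sub>R cnj l *\<^sub>C T1 y) \<le> C * (norm (y - (1 - s) *\<^sub>R cnj l *\<^sub>C T1 y))\<^sup>2"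
      using harnack_dominated_radial_bound[OF T0 T1 assms(4) l _ inv] by metis
    then obtain d where "d > 0" "\<And>y. d * norm y \<le> norm (y - cnj l *\<^sub>C T1 y)"
      using bounded_below_of_radial_bound[of s0 C "\<lambda>y. cnj l *\<^sub>C T1 y"] by blast
    then have "\<exists>S. op_inverse_of (\<lambda>x. x - cnj l *\<^sub>C T1 x) S"
      using invertible_of_bounded_below_radial[OF T1 l inv] by blast
    then have "l \<notin> spectrum_op T1" using notin_spectrum_op_iff[OF T1 l] by blast
    then show False using l1 by (simp add: peripheral_spectrum_def)
  qed
  then show "l \<in> peripheral_spectrum T0" using l by (simp add: peripheral_spectrum_def)
qed

end
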